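(* Let $\mathfrak R$ be a complete, separated topological ring with a base of neighborhoods of zero formed by open right ideals, and let $H\subset\mathfrak R$ be a left ideal. Then $H$ is topologically left T-nilpotent (as a topological ring without unit in the topology induced from $\mathfrak R$) if and only if for any nonzero discrete right $\mathfrak R$-module $\mathcal N$ the submodule $\mathcal N_H=\{b\in\mathcal N\mid bh=0\text{ for all }h\in H\}\subset\mathcal N$ is also nonzero.
   Context: Rings are associative with unit unless said otherwise. A topological ring is separated (resp. complete) if the natural map $\mathfrak R\to\varprojlim_{\mathfrak U}\mathfrak R/\mathfrak U$, over all open additive subgroups $\mathfrak U$, is injective (resp. surjective). A right $\mathfrak R$-module $\mathcal N$ is discrete if the annihilator of every element of $\mathcal N$ is an open right ideal in $\mathfrak R$. A separated topological ring without unit $H$ is topologically left T-nilpotent if for any sequence $a_1,a_2,a_3,\dots$ of elements of $H$ the sequence $a_1,\ a_1a_2,\ a_1a_2a_3,\ \dots,\ a_1a_2\cdots a_n,\ \dots$ converges to zero in the topology of $H$. *)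

theory Defs
  imports
    "HOL-Algebra.AbelCoset"
    "HOL-Analysis.Product_Topology"
    "HOL-Analysis.Abstract_Limits"
begin

section \<open>One-sided ideals and right modules\<close>

definition left_ideal :: "'a set \<Rightarrow> ('a, 'm) ring_scheme \<Rightarrow> bool" where
  "left_ideal I R \<longleftrightarrow>
     additive_subgroup I R \<and> (\<forall>r\<in>carrier R. \<forall>x\<in>I. r \<otimes>\<^bsub>R\<^esub> x \<in> I)"

definition right_ideal :: "'a set \<Rightarrow> ('a, 'm) ring_scheme \<Rightarrow> bool" where
  "right_ideal I R \<longleftrightarrow>
     additive_subgroup I R \<and> (\<forall>x\<in>I. \<forall>r\<in>carrier R. x \<otimes>\<^bsub>R\<^esub> r \<in> I)"

text \<open>As for the library's \<open>module\<close> record, only the additive part of the underlying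
  \<open>ring\<close> record is used; its fields \<open>mult\<close> and \<open>one\<close> are irrelevant.\<close>

record ('a, 'b) right_module = "'b ring" +
  ract :: "'b \<Rightarrow> 'a \<Rightarrow> 'b" (infixl \<open>\<star>\<index>\<close> 70)

locale right_module = R?: ring R + N?: abelian_group N
  for R :: "('a, 'm) ring_scheme" (structure)
    and N :: "('a, 'b, 'n) right_module_scheme" (structure) +
  assumes ract_closed: "\<lbrakk>b \<in> carrier N; r \<in> carrier R\<rbrakk> \<Longrightarrow> b \<star>\<^bsub>N\<^esub> r \<in> carrier N"
    and ract_add_left: "\<lbrakk>b \<in> carrier N; c \<in> carrier N; r \<in> carrier R\<rbrakk>
      \<Longrightarrow> (b \<oplus>\<^bsub>N\<^esub> c) \<star>\<^bsub>N\<^esub> r = b \<star>\<^bsub>N\<^esub> r \<oplus>\<^bsub>N\<^esub> c \<star>\<^bsub>N\<^esub> r"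
    and ract_add_right: "\<lbrakk>b \<in> carrier N; r \<in> carrier R; s \<in> carrier R\<rbrakk>
      \<Longrightarrow> b \<star>\<^bsub>N\<^esub> (r \<oplus>\<^bsub>R\<^esub> s) = b \<star>\<^bsub>N\<^esub> r \<oplus>\<^bsub>N\<^esub> b \<star>\<^bsub>N\<^esub> s"
    and ract_mult: "\<lbrakk>b \<in> carrier N; r \<in> carrier R; s \<in> carrier R\<rbrakk>
      \<Longrightarrow> b \<star>\<^bsub>N\<^esub> (r \<otimes>\<^bsub>R\<^esub> s) = (b \<star>\<^bsub>N\<^esub> r) \<star>\<^bsub>N\<^esub> s"
    and ract_one: "b \<in> carrier N \<Longrightarrow> b \<star>\<^bsub>N\<^esub> \<one>\<^bsub>R\<^esub> = b"

section \<open>Topological rings\<close>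

locale topological_ring = ring R
  for R :: "('a, 'm) ring_scheme" (structure) and T :: "'a topology" +
  assumes topspace_eq: "topspace T = carrier R"
    and continuous_add: "continuous_map (prod_topology T T) T (\<lambda>(x, y). x \<oplus> y)"
    and continuous_minus: "continuous_map T T (\<lambda>x. \<ominus> x)"
    and continuous_mult: "continuous_map (prod_topology T T) T (\<lambda>(x, y). x \<otimes> y)"

definition open_subgroups :: "('a, 'm) ring_scheme \<Rightarrow> 'a topology \<Rightarrow> 'a set set" where
  "open_subgroups R T = {U. additive_subgroup U R \<and> openin T U}"

text \<open>The projective limit of the quotient groups \<open>R/U\<close> over all open subgroups \<open>U\<close>; for
  \<open>U \<subseteq> V\<close> the transition map \<open>R/U \<rightarrow> R/V\<close> sends a coset \<open>C\<close> to \<open>V + C\<close>.\<close>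

definition quotient_limit :: "('a, 'm) ring_scheme \<Rightarrow> 'a topology \<Rightarrow> ('a set \<Rightarrow> 'a set) set" where
  "quotient_limit R T =
     {x \<in> (\<Pi>\<^sub>E U\<in>open_subgroups R T. a_rcosets\<^bsub>R\<^esub> U).
        \<forall>U\<in>open_subgroups R T. \<forall>V\<in>open_subgroups R T. U \<subseteq> V \<longrightarrow> V <+>\<^bsub>R\<^esub> x U = x V}"

definition to_quotient_limit ::
    "('a, 'm) ring_scheme \<Rightarrow> 'a topology \<Rightarrow> 'a \<Rightarrow> ('a set \<Rightarrow> 'a set)" where
  "to_quotient_limit R T r = (\<lambda>U\<in>open_subgroups R T. U +>\<^bsub>R\<^esub> r)"

definition separated_ring :: "('a, 'm) ring_scheme \<Rightarrow> 'a topology \<Rightarrow> bool" where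
  "separated_ring R T \<longleftrightarrow> inj_on (to_quotient_limit R T) (carrier R)"

definition complete_ring :: "('a, 'm) ring_scheme \<Rightarrow> 'a topology \<Rightarrow> bool" where
  "complete_ring R T \<longleftrightarrow> to_quotient_limit R T ` carrier R = quotient_limit R T"

definition right_linear_topology :: "('a, 'm) ring_scheme \<Rightarrow> 'a topology \<Rightarrow> bool" where
  "right_linear_topology R T \<longleftrightarrow>
     (\<forall>W. openin T W \<and> \<zero>\<^bsub>R\<^esub> \<in> W \<longrightarrow> (\<exists>I. right_ideal I R \<and> openin T I \<and> I \<subseteq> W))"

section \<open>Topological T-nilpotence\<close>

text \<open>\<open>partial_product R a n\<close> is \<open>a 0 \<otimes> a 1 \<otimes> \<dots> \<otimes> a n\<close>.\<close>

primrec partial_product :: "('a, 'm) ring_scheme \<Rightarrow> (nat \<Rightarrow> 'a) \<Rightarrow> nat \<Rightarrow> 'a" where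
  "partial_product R a 0 = a 0"
| "partial_product R a (Suc n) = partial_product R a n \<otimes>\<^bsub>R\<^esub> a (Suc n)"

text \<open>The field \<open>one\<close> of the record plays no role here, so that the notion makes sense for rings
  without unit.\<close>

definition topologically_left_T_nilpotent :: "('a, 'm) ring_scheme \<Rightarrow> 'a topology \<Rightarrow> bool" where
  "topologically_left_T_nilpotent H S \<longleftrightarrow>
     (\<forall>a. (\<forall>n. a n \<in> carrier H) \<longrightarrow> limitin S (partial_product H a) \<zero>\<^bsub>H\<^esub> sequentially)"

section \<open>Discrete right modules\<close>

definition discrete_right_module ::
    "('a, 'm) ring_scheme \<Rightarrow> 'a topology \<Rightarrow> ('a, 'b, 'n) right_module_scheme \<Rightarrow> bool" where
  "discrete_right_module R T N \<longleftrightarrow>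
     right_module R N \<and>
     (\<forall>b\<in>carrier N. let A = {r \<in> carrier R. b \<star>\<^bsub>N\<^esub> r = \<zero>\<^bsub>N\<^esub>} in right_ideal A R \<and> openin T A)"

definition annihilated_part :: "('a, 'b, 'n) right_module_scheme \<Rightarrow> 'a set \<Rightarrow> 'b set" where
  "annihilated_part N H = {b \<in> carrier N. \<forall>h\<in>H. b \<star>\<^bsub>N\<^esub> h = \<zero>\<^bsub>N\<^esub>}"

text \<open>A HOL formula cannot quantify over modules of all carrier types at once. Carriers of type
  \<open>'a set\<close>, for a ring over \<open>'a\<close>, accommodate every quotient \<open>R/V\<close> by a right ideal (as a set of
  cosets), hence every cyclic module up to isomorphism; statements about all discrete modules
  use this type where they assume something of all modules, and an arbitrary one where they
  conclude something about all modules.\<close>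

end

theory Submission
  imports Defs
begin

text \<open>If \<open>b\<close> is an element of a discrete module that cannot be killed by successive
  multiplications with elements of \<open>H\<close>, then these multipliers form a sequence whose partial
  products stay outside the annihilator of \<open>b\<close>, an open neighbourhood of zero.

  Conversely, suppose that the partial products of a sequence \<open>a\<close> in \<open>H\<close> avoid an open right ideal,
  and let \<open>J\<close> be maximal among the right ideals above it that contain no partial product.
  In \<open>R/J\<close> no nonzero element \<open>J + x\<close> is annihilated by \<open>H\<close>: by maximality some
  partial product is of the form \<open>j + x r\<close>, and the next one is \<open>j a' + x (r a')\<close>, where
  \<open>r a'\<close> lies in the left ideal \<open>H\<close>; so \<open>x H \<subseteq> J\<close> would put it into \<open>J\<close>.\<close>

section \<open>Right ideals\<close>

text \<open>Additive inverses need no separate check: the unit gives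
  \<open>\<ominus> x = x \<otimes> \<ominus> \<one>\<close>, so closure under right multiplication
  covers them.\<close>

lemma (in ring) right_idealI:
  assumes sub: "I \<subseteq> carrier R" and zero: "\<zero> \<in> I"
    and add: "\<And>x y. \<lbrakk>x \<in> I; y \<in> I\<rbrakk> \<Longrightarrow> x \<oplus> y \<in> I"
    and mult: "\<And>x r. \<lbrakk>x \<in> I; r \<in> carrier R\<rbrakk> \<Longrightarrow> x \<otimes> r \<in> I"
  shows "right_ideal I R"
proof -
  have "\<ominus> x \<in> I" if "x \<in> I" for x
    using mult[OF that, of "\<ominus> \<one>"] sub that by (auto simp: r_minus subset_iff)
  then have "subgroup I (add_monoid R)"
    using assms by (intro add.subgroupI) auto
  then show ?thesis
    using mult by (auto simp: right_ideal_def intro: additive_subgroupI)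
qed

lemma right_idealD:
  assumes "right_ideal I R"
  shows "additive_subgroup I R"
    and "\<And>x r. \<lbrakk>x \<in> I; r \<in> carrier R\<rbrakk> \<Longrightarrow> x \<otimes>\<^bsub>R\<^esub> r \<in> I"
  using assms by (auto simp: right_ideal_def)

text \<open>This is the right ideal \<open>J + xR\<close>, the enlargement of \<open>J\<close>
  against which maximality is later tested.\<close>

lemma (in ring) right_ideal_sum_principal:
  assumes J: "right_ideal J R" and x: "x \<in> carrier R"
  defines "K \<equiv> {j \<oplus> x \<otimes> r | j r. j \<in> J \<and> r \<in> carrier R}"
  shows "right_ideal K R" and "J \<subseteq> K" and "x \<in> K"
proof -
  interpret J: additive_subgroup J R
    using right_idealD(1)[OF J] .
  have K: "j \<oplus> x \<otimes> r \<in> K" if "j \<in> J" "r \<in> carrier R" for j r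
    using that by (auto simp: K_def)
  show "J \<subseteq> K"
    using K[of _ \<zero>] x by auto
  show "x \<in> K"
    using K[of \<zero> \<one>] x by auto
  show "right_ideal K R"
  proof (rule right_idealI)
    show "K \<subseteq> carrier R"
      using x by (auto simp: K_def)
    show "\<zero> \<in> K"
      using \<open>J \<subseteq> K\<close> by auto
  next
    fix y z assume "y \<in> K" "z \<in> K"
    then obtain j r k s where y: "y = j \<oplus> x \<otimes> r" and z: "z = k \<oplus> x \<otimes> s"
      and m: "j \<in> J" "k \<in> J" "r \<in> carrier R" "s \<in> carrier R"
      by (auto simp: K_def)
    have "y \<oplus> z = (j \<oplus> k) \<oplus> x \<otimes> (r \<oplus> s)"
      using m x by (simp add: y z r_distr a_ac)
    then show "y \<oplus> z \<in> K"
      using K m by simp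
  next
    fix y s assume "y \<in> K" "s \<in> carrier R"
    then obtain j r where y: "y = j \<oplus> x \<otimes> r" and m: "j \<in> J" "r \<in> carrier R" "s \<in> carrier R"
      by (auto simp: K_def)
    have "y \<otimes> s = j \<otimes> s \<oplus> x \<otimes> (r \<otimes> s)"
      using m x by (simp add: y l_distr m_assoc)
    then show "y \<otimes> s \<in> K"
      using K m right_idealD(2)[OF J] by simp
  qed
qed

text \<open>Only sums are at issue: two members of a chain are comparable, so both summands lie in
  the larger one.\<close>

lemma (in ring) right_ideal_Union_chain:
  assumes "\<C> \<noteq> {}" and chain: "subset.chain {I. right_ideal I R} \<C>"
  shows "right_ideal (\<Union>\<C>) R"
proof (rule right_idealI)
  have ideals: "right_ideal I R" if "I \<in> \<C>" for I
    using chain that by (auto simp: subset.chain_def)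
  note subgroups = right_idealD(1)[OF ideals]
  show "\<Union>\<C> \<subseteq> carrier R"
    using subgroups by (auto dest: additive_subgroup.a_Hcarr)
  show "\<zero> \<in> \<Union>\<C>"
    using assms(1) subgroups by (auto dest: additive_subgroup.zero_closed)
  show "x \<otimes> r \<in> \<Union>\<C>" if "x \<in> \<Union>\<C>" "r \<in> carrier R" for x r
    using that ideals by (auto dest: right_idealD(2))
  show "x \<oplus> y \<in> \<Union>\<C>" if xy: "x \<in> \<Union>\<C>" "y \<in> \<Union>\<C>" for x y
  proof -
    obtain A B where AB: "x \<in> A" "A \<in> \<C>" "y \<in> B" "B \<in> \<C>"
      using xy by auto
    then have "A \<subseteq> B \<or> B \<subseteq> A"
      using chain by (auto simp: subset.chain_def)
    then have "x \<oplus> y \<in> A \<or> x \<oplus> y \<in> B"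
      using AB by (auto intro: additive_subgroup.a_closed[OF subgroups])
    then show ?thesis
      using AB by auto
  qed
qed

text \<open>Zorn's lemma applies because the union of a nonempty chain of right ideals avoiding
  \<open>S\<close> again avoids \<open>S\<close>. It is used with \<open>S\<close> the set of
  partial products of a sequence.\<close>

lemma (in ring) right_ideal_maximal_disjoint:
  assumes I: "right_ideal I R" and dis: "I \<inter> S = {}"
  obtains J where "right_ideal J R" "I \<subseteq> J" "J \<inter> S = {}"
    and "\<And>K. \<lbrakk>right_ideal K R; J \<subset> K\<rbrakk> \<Longrightarrow> K \<inter> S \<noteq> {}"
proof -
  let ?A = "{J. right_ideal J R \<and> I \<subseteq> J \<and> J \<inter> S = {}}"
  have "\<exists>J\<in>?A. \<forall>K\<in>?A. J \<subseteq> K \<longrightarrow> K = J"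
  proof (rule subset_Zorn_nonempty)
    show "?A \<noteq> {}"
      using assms by auto
  next
    fix \<C> assume ne: "\<C> \<noteq> {}" and ch: "subset.chain ?A \<C>"
    then have "right_ideal (\<Union>\<C>) R"
      by (intro right_ideal_Union_chain) (auto simp: subset.chain_def)
    moreover have "I \<subseteq> \<Union>\<C>" "\<Union>\<C> \<inter> S = {}"
      using ne ch by (fastforce simp: subset.chain_def)+
    ultimately show "\<Union>\<C> \<in> ?A"
      by simp
  qed
  then obtain J where J: "J \<in> ?A" and max: "\<forall>K\<in>?A. J \<subseteq> K \<longrightarrow> K = J"
    by (rule bexE)
  show ?thesis
  proof (rule that[of J])
    fix K assume "right_ideal K R" "J \<subset> K"
    then show "K \<inter> S \<noteq> {}"
      using J max[rule_format, of K] by auto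
  qed (use J in auto)
qed

section \<open>Open subgroups\<close>

context topological_ring
begin

lemma continuous_map_add_const:
  assumes "c \<in> carrier R"
  shows "continuous_map T T (\<lambda>y. y \<oplus> c)"
proof -
  have "continuous_map T (prod_topology T T) (\<lambda>y. (y, c))"
    using assms topspace_eq by (auto simp: continuous_map_pairwise o_def)
  from continuous_map_compose[OF this continuous_add] show ?thesis
    by (simp add: o_def)
qed

lemma continuous_map_const_mult:
  assumes "c \<in> carrier R"
  shows "continuous_map T T (\<lambda>y. c \<otimes> y)"
proof -
  have "continuous_map T (prod_topology T T) (\<lambda>y. (c, y))"
    using assms topspace_eq by (auto simp: continuous_map_pairwise o_def)
  from continuous_map_compose[OF this continuous_mult] show ?thesis
    by (simp add: o_def)
qed

lemma openin_superset_subgroup: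
  assumes I: "openin T I" "\<zero> \<in> I" and K: "additive_subgroup K R" and "I \<subseteq> K"
  shows "openin T K"
proof (subst openin_subopen, intro ballI)
  fix k assume k: "k \<in> K"
  interpret K: additive_subgroup K R by fact
  let ?U = "{y \<in> topspace T. y \<oplus> \<ominus> k \<in> I}"
  have "openin T ?U"
    using k by (intro openin_continuous_map_preimage[OF continuous_map_add_const I(1)]) auto
  moreover have "k \<in> ?U"
    using k I(2) topspace_eq by (auto simp: r_neg)
  moreover have "?U \<subseteq> K"
  proof
    fix y assume "y \<in> ?U"
    then have y: "y \<in> carrier R" "y \<oplus> \<ominus> k \<in> K"
      using topspace_eq \<open>I \<subseteq> K\<close> by auto
    have "(y \<oplus> \<ominus> k) \<oplus> k \<in> K"
      using y k by blast
    then show "y \<in> K"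
      using y k by (simp add: a_assoc l_neg)
  qed
  ultimately show "\<exists>U. openin T U \<and> k \<in> U \<and> U \<subseteq> K"
    by blast
qed

end

section \<open>Annihilators and cyclic modules\<close>

context right_module
begin

lemma ract_zero_right:
  assumes b: "b \<in> carrier N"
  shows "b \<star>\<^bsub>N\<^esub> \<zero>\<^bsub>R\<^esub> = \<zero>\<^bsub>N\<^esub>"
proof -
  have "b \<star>\<^bsub>N\<^esub> \<zero>\<^bsub>R\<^esub> \<oplus>\<^bsub>N\<^esub> b \<star>\<^bsub>N\<^esub> \<zero>\<^bsub>R\<^esub> = b \<star>\<^bsub>N\<^esub> \<zero>\<^bsub>R\<^esub>"
    using ract_add_right[OF b R.zero_closed R.zero_closed] by simp
  then show ?thesis
    using ract_closed[OF b R.zero_closed] by (simp add: N.add.l_cancel_one)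
qed

lemma ract_zero_left:
  assumes r: "r \<in> carrier R"
  shows "\<zero>\<^bsub>N\<^esub> \<star>\<^bsub>N\<^esub> r = \<zero>\<^bsub>N\<^esub>"
proof -
  have "\<zero>\<^bsub>N\<^esub> \<star>\<^bsub>N\<^esub> r \<oplus>\<^bsub>N\<^esub> \<zero>\<^bsub>N\<^esub> \<star>\<^bsub>N\<^esub> r = \<zero>\<^bsub>N\<^esub> \<star>\<^bsub>N\<^esub> r"
    using ract_add_left[OF N.zero_closed N.zero_closed r] by simp
  then show ?thesis
    using ract_closed[OF N.zero_closed r] by (simp add: N.add.l_cancel_one)
qed

lemma right_ideal_annihilator:
  assumes "b \<in> carrier N"
  shows "right_ideal {r \<in> carrier R. b \<star>\<^bsub>N\<^esub> r = \<zero>\<^bsub>N\<^esub>} R"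
  using assms
  by (intro R.right_idealI)
    (auto simp: ract_zero_right ract_add_right ract_mult ract_zero_left)

text \<open>Excludes the empty set, so that an annihilated part other than the zero singleton must
  contain a nonzero element.\<close>

lemma zero_in_annihilated_part:
  assumes "H \<subseteq> carrier R"
  shows "\<zero>\<^bsub>N\<^esub> \<in> annihilated_part N H"
  using assms by (auto simp: annihilated_part_def ract_zero_left)

end

text \<open>On cosets of a right ideal \<open>J\<close> the members of the union defining the action coincide.\<close>

definition quotient_module :: "('a, 'm) ring_scheme \<Rightarrow> 'a set \<Rightarrow> ('a, 'a set) right_module" where
  "quotient_module R J =
     \<lparr>carrier = a_rcosets\<^bsub>R\<^esub> J, mult = (\<lambda>_ _. J), one = J, zero = J, add = set_add R,
      ract = (\<lambda>C r. \<Union>y\<in>C. J +>\<^bsub>R\<^esub> (y \<otimes>\<^bsub>R\<^esub> r))\<rparr>"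

lemma quotient_module_simps [simp]:
  "carrier (quotient_module R J) = a_rcosets\<^bsub>R\<^esub> J"
  "zero (quotient_module R J) = J"
  "add (quotient_module R J) = set_add R"
  by (simp_all add: quotient_module_def)

lemma abelian_group_quotient_module:
  assumes "abelian_subgroup J R"
  shows "abelian_group (quotient_module R J)"
proof -
  interpret abelian_subgroup J R by fact
  show ?thesis
  proof (rule abelian_groupI)
    fix C assume "C \<in> carrier (quotient_module R J)"
    then obtain x where x: "x \<in> carrier R" "C = J +>\<^bsub>R\<^esub> x"
      by (auto simp: A_RCOSETS_def')
    have "J +>\<^bsub>R\<^esub> \<ominus>\<^bsub>R\<^esub> x \<in> a_rcosets\<^bsub>R\<^esub> J" "J +>\<^bsub>R\<^esub> \<ominus>\<^bsub>R\<^esub> x <+>\<^bsub>R\<^esub> C = J"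
      using x a_rcosetsI[OF a_subset, of "\<ominus>\<^bsub>R\<^esub> x"]
      by (simp_all add: a_rcos_sum l_neg a_rcos_const)
    then show "\<exists>D\<in>carrier (quotient_module R J). D \<oplus>\<^bsub>quotient_module R J\<^esub> C = \<zero>\<^bsub>quotient_module R J\<^esub>"
      by auto
  next
    fix C D assume "C \<in> carrier (quotient_module R J)" "D \<in> carrier (quotient_module R J)"
    then obtain x y where "x \<in> carrier R" "C = J +>\<^bsub>R\<^esub> x" "y \<in> carrier R" "D = J +>\<^bsub>R\<^esub> y"
      by (auto simp: A_RCOSETS_def')
    then show "C \<oplus>\<^bsub>quotient_module R J\<^esub> D = D \<oplus>\<^bsub>quotient_module R J\<^esub> C"
      by (simp add: a_rcos_sum a_comm)
  qed (simp_all add: a_setmult_closed a_rcosets_assoc a_subgroup_in_rcosets rcosets_add_eq)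
qed

context ring
begin

lemma right_ideal_abelian_subgroup:
  "right_ideal J R \<Longrightarrow> abelian_subgroup J R"
  using abelian_subgroupI3 right_idealD(1) abelian_group_axioms by blast

lemma right_ideal_coset_eq_iff:
  assumes "right_ideal J R" "x \<in> carrier R"
  shows "J +> x = J \<longleftrightarrow> x \<in> J"
  using abelian_subgroup.a_rcos_self[OF right_ideal_abelian_subgroup]
    abelian_subgroup.a_rcos_const[OF right_ideal_abelian_subgroup] assms by metis

text \<open>The action is well defined: if \<open>y\<close> and \<open>x\<close> differ by an
  element of \<open>J\<close>, then so do \<open>y \<otimes> r\<close> and
  \<open>x \<otimes> r\<close>, because \<open>J\<close> is a right ideal. The union in the
  definition thus ranges over equal cosets.\<close>

lemma ract_quotient_module:
  assumes J: "right_ideal J R" and x: "x \<in> carrier R" and r: "r \<in> carrier R"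
  shows "(J +> x) \<star>\<^bsub>quotient_module R J\<^esub> r = J +> (x \<otimes> r)"
proof -
  interpret J: abelian_subgroup J R
    by (rule right_ideal_abelian_subgroup[OF J])
  have eq: "J +> (y \<otimes> r) = J +> (x \<otimes> r)" if "y \<in> J +> x" for y
  proof -
    have y: "y \<in> carrier R" "y \<oplus> \<ominus> x \<in> J"
      using that x J.a_elemrcos_carrier J.a_rcos_module_imp by auto
    have "(y \<oplus> \<ominus> x) \<otimes> r \<in> J"
      using right_idealD(2)[OF J] y r by blast
    then have "y \<otimes> r \<oplus> \<ominus> (x \<otimes> r) \<in> J"
      using x y r by (simp add: l_distr l_minus)
    then have "y \<otimes> r \<in> J +> (x \<otimes> r)"
      using x y r by (simp add: J.a_rcos_module)
    then show ?thesis
      using J.a_repr_independence'[of "y \<otimes> r" "x \<otimes> r"] x r by simp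
  qed
  have "(\<Union>y\<in>J +> x. J +> (y \<otimes> r)) = J +> (x \<otimes> r)"
  proof (rule SUP_eq_const)
    show "J +> x \<noteq> {}"
      using J.a_rcos_self[OF x] by blast
  qed (rule eq)
  then show ?thesis
    by (simp add: quotient_module_def)
qed

lemma right_module_quotient_module:
  assumes J: "right_ideal J R"
  shows "right_module R (quotient_module R J)"
proof -
  interpret J: abelian_subgroup J R
    by (rule right_ideal_abelian_subgroup[OF J])
  interpret N: abelian_group "quotient_module R J"
    by (rule abelian_group_quotient_module) unfold_locales
  show ?thesis
    by unfold_locales
      (auto simp: A_RCOSETS_def' ract_quotient_module[OF J] J.a_rcos_sum l_distr r_distr m_assoc)
qed

end

text \<open>The annihilator of the coset of \<open>x\<close> is the preimage of \<open>J\<close>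
  under left multiplication by \<open>x\<close>, hence open by continuity.\<close>

lemma (in topological_ring) discrete_quotient_module:
  assumes J: "right_ideal J R" "openin T J"
  shows "discrete_right_module R T (quotient_module R J)"
proof -
  interpret N: right_module R "quotient_module R J"
    by (rule right_module_quotient_module[OF J(1)])
  have "openin T {r \<in> carrier R. b \<star>\<^bsub>quotient_module R J\<^esub> r = J}" if b: "b \<in> a_rcosets J" for b
  proof -
    obtain x where x: "x \<in> carrier R" "b = J +> x"
      using b by (auto simp: A_RCOSETS_def')
    have "b \<star>\<^bsub>quotient_module R J\<^esub> r = J \<longleftrightarrow> x \<otimes> r \<in> J" if "r \<in> carrier R" for r
      using x that
      by (simp add: ract_quotient_module[OF J(1)] right_ideal_coset_eq_iff[OF J(1)])
    then have "{r \<in> carrier R. b \<star>\<^bsub>quotient_module R J\<^esub> r = J} = {r \<in> topspace T. x \<otimes> r \<in> J}"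
      unfolding topspace_eq by (intro Collect_cong conj_cong refl)
    then show ?thesis
      using openin_continuous_map_preimage[OF continuous_map_const_mult J(2)] x by simp
  qed
  then show ?thesis
    using N.right_ideal_annihilator N.right_module_axioms
    by (auto simp: discrete_right_module_def Let_def)
qed

section \<open>T-nilpotence and discrete modules\<close>

text \<open>Restricting the carrier leaves the multiplication alone, so products formed in
  \<open>H\<close> may be computed in \<open>R\<close>.\<close>

lemma partial_product_carrier_update [simp]:
  "partial_product (R\<lparr>carrier := H\<rparr>) a = partial_product R a"
proof
  show "partial_product (R\<lparr>carrier := H\<rparr>) a n = partial_product R a n" for n
    by (induction n) auto
qed

lemma (in ring) partial_product_left_ideal:
  assumes "left_ideal H R" "\<And>n. a n \<in> H"
  shows "partial_product R a n \<in> H"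
proof -
  interpret H: additive_subgroup H R
    using assms(1) by (simp add: left_ideal_def)
  show ?thesis
    using assms by (induction n) (auto simp: left_ideal_def)
qed

lemma T_nilpotent_imp_annihilated_part_nonzero:
  fixes R :: "('a, 'm) ring_scheme" (structure) and N :: "('a, 'b, 'n) right_module_scheme"
  assumes "topological_ring R T" and H: "left_ideal H R"
    and nil: "topologically_left_T_nilpotent (R\<lparr>carrier := H\<rparr>) (subtopology T H)"
    and N: "discrete_right_module R T N" and ne: "carrier N \<noteq> {\<zero>\<^bsub>N\<^esub>}"
  shows "annihilated_part N H \<noteq> {\<zero>\<^bsub>N\<^esub>}"
proof
  assume trivial: "annihilated_part N H = {\<zero>\<^bsub>N\<^esub>}"
  interpret topological_ring R T by fact
  interpret N: right_module R N
    using N by (simp add: discrete_right_module_def)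
  interpret H: additive_subgroup H R
    using H by (simp add: left_ideal_def)
  \<comment> \<open>The guard sits under the existential so that choice yields a total function
    \<open>f\<close>; its values matter only at nonzero elements of \<open>N\<close>.\<close>
  have "\<forall>b. \<exists>h. b \<in> carrier N \<and> b \<noteq> \<zero>\<^bsub>N\<^esub> \<longrightarrow> h \<in> H \<and> b \<star>\<^bsub>N\<^esub> h \<noteq> \<zero>\<^bsub>N\<^esub>"
    using trivial unfolding annihilated_part_def by blast
  then obtain f where f: "\<And>b. \<lbrakk>b \<in> carrier N; b \<noteq> \<zero>\<^bsub>N\<^esub>\<rbrakk> \<Longrightarrow> f b \<in> H \<and> b \<star>\<^bsub>N\<^esub> f b \<noteq> \<zero>\<^bsub>N\<^esub>"
    by metis
  obtain b where b: "b \<in> carrier N" "b \<noteq> \<zero>\<^bsub>N\<^esub>"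
    using ne N.zero_closed by blast
  \<comment> \<open>\<open>c\<close> is the orbit of \<open>b\<close> obtained by multiplying at
    each stage with the element of \<open>H\<close> that \<open>f\<close> selects; \<open>a\<close>
    records these multipliers.\<close>
  define c where "c = rec_nat b (\<lambda>_ x. x \<star>\<^bsub>N\<^esub> f x)"
  define a where "a n = f (c n)" for n
  have c_simps: "c 0 = b" "c (Suc n) = c n \<star>\<^bsub>N\<^esub> a n" for n
    by (simp_all add: c_def a_def)
  have c: "c n \<in> carrier N \<and> c n \<noteq> \<zero>\<^bsub>N\<^esub>" for n
  proof (induction n)
    case 0
    then show ?case using b by (simp add: c_simps)
  next
    case (Suc n)
    then show ?case using f[of "c n"] by (auto simp: c_simps a_def intro: N.ract_closed)
  qed
  have a: "a n \<in> H" for n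
    using c f by (simp add: a_def)
  \<comment> \<open>The index shifts by one: the product up to \<open>a n\<close> has
    \<open>n + 1\<close> factors.\<close>
  have products: "b \<star>\<^bsub>N\<^esub> partial_product R a n = c (Suc n)" for n
  proof (induction n)
    case 0
    then show ?case by (simp add: c_simps)
  next
    case (Suc n)
    have "partial_product R a n \<in> carrier R"
      using partial_product_left_ideal[OF H a] by simp
    then show ?case
      using Suc b a by (simp add: N.ract_mult c_simps)
  qed
  let ?A = "{r \<in> carrier R. b \<star>\<^bsub>N\<^esub> r = \<zero>\<^bsub>N\<^esub>}"
  have "limitin T (partial_product R a) \<zero> sequentially"
    using nil a by (simp add: topologically_left_T_nilpotent_def limitin_subtopology)
  moreover have "openin T ?A"
    using N b by (simp add: discrete_right_module_def Let_def)
  moreover have "\<zero> \<in> ?A"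
    using b N.ract_zero_right by simp
  ultimately have "eventually (\<lambda>n. partial_product R a n \<in> ?A) sequentially"
    unfolding limitin_def by blast
  then obtain n where "partial_product R a n \<in> ?A"
    by (auto simp: eventually_sequentially)
  then show False
    using products c by auto
qed

text \<open>The assumption on modules is applied only to quotients \<open>R/J\<close>, whose
  elements are cosets; this is why carriers of type \<open>'a set\<close> suffice.\<close>

lemma annihilated_part_nonzero_imp_T_nilpotent:
  fixes R :: "('a, 'm) ring_scheme" (structure)
  assumes "topological_ring R T" and "right_linear_topology R T" and H: "left_ideal H R"
    and ann: "\<And>N :: ('a, 'a set) right_module.
      \<lbrakk>discrete_right_module R T N; carrier N \<noteq> {\<zero>\<^bsub>N\<^esub>}\<rbrakk> \<Longrightarrow> annihilated_part N H \<noteq> {\<zero>\<^bsub>N\<^esub>}"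
  shows "topologically_left_T_nilpotent (R\<lparr>carrier := H\<rparr>) (subtopology T H)"
proof -
  interpret topological_ring R T by fact
  interpret H: additive_subgroup H R
    using H by (simp add: left_ideal_def)
  have "\<exists>n. partial_product R a n \<in> I"
    if a: "\<And>n. a n \<in> H" and I: "right_ideal I R" "openin T I" for a I
  proof (rule ccontr)
    let ?p = "partial_product R a"
    assume "\<not> ?thesis"
    then have "I \<inter> range ?p = {}"
      by auto
    then obtain J where J: "right_ideal J R" "I \<subseteq> J" "J \<inter> range ?p = {}"
      and max: "\<And>K. \<lbrakk>right_ideal K R; J \<subset> K\<rbrakk> \<Longrightarrow> K \<inter> range ?p \<noteq> {}"
      using right_ideal_maximal_disjoint I(1) by metis
    interpret J: additive_subgroup J R
      using right_idealD(1)[OF J(1)] .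
    \<comment> \<open>Openness passes from \<open>I\<close> up to \<open>J\<close>, which makes
      \<open>R/J\<close> discrete.\<close>
    have "openin T J"
      using openin_superset_subgroup[OF I(2) _ J.additive_subgroup_axioms J(2)]
        additive_subgroup.zero_closed[OF right_idealD(1)[OF I(1)]] by simp
    let ?N = "quotient_module R J"
    interpret N: right_module R ?N
      by (rule right_module_quotient_module[OF J(1)])
    have p: "?p n \<in> carrier R" for n
      using partial_product_left_ideal[OF H a] by simp
    \<comment> \<open>\<open>R/J\<close> is nonzero: \<open>J\<close> avoids every partial product,
      in particular the first.\<close>
    have "J +> ?p 0 \<in> carrier ?N"
      using a_rcosetsI[OF J.a_subset p[of 0]] by simp
    moreover have "J +> ?p 0 \<noteq> J"
      using right_ideal_coset_eq_iff[OF J(1) p[of 0]] J(3) by blast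
    ultimately have "carrier ?N \<noteq> {\<zero>\<^bsub>?N\<^esub>}"
      by auto
    then have "annihilated_part ?N H \<noteq> {\<zero>\<^bsub>?N\<^esub>}"
      using ann discrete_quotient_module[OF J(1) \<open>openin T J\<close>] by blast
    moreover have "\<zero>\<^bsub>?N\<^esub> \<in> annihilated_part ?N H"
      using N.zero_in_annihilated_part H.a_subset .
    ultimately obtain C where C: "C \<in> annihilated_part ?N H" "C \<noteq> J"
      by auto
    then obtain x where x: "x \<in> carrier R" "C = J +> x"
      by (auto simp: annihilated_part_def A_RCOSETS_def')
    have xH: "x \<otimes> h \<in> J" if "h \<in> H" for h
      using C(1) that x
      by (simp add: annihilated_part_def ract_quotient_module[OF J(1)]
          right_ideal_coset_eq_iff[OF J(1)])
    have "x \<notin> J"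
      using C(2) x right_ideal_coset_eq_iff[OF J(1)] by simp
    let ?K = "{j \<oplus> x \<otimes> r | j r. j \<in> J \<and> r \<in> carrier R}"
    \<comment> \<open>Since \<open>x\<close> lies outside \<open>J\<close>, the sum
      \<open>J + xR\<close> is strictly larger and by maximality contains a partial product.\<close>
    have "right_ideal ?K R" "J \<subset> ?K"
      using right_ideal_sum_principal[OF J(1) x(1)] \<open>x \<notin> J\<close> by auto
    from max[OF this] obtain n j r where n: "?p n = j \<oplus> x \<otimes> r" and j: "j \<in> J" and r: "r \<in> carrier R"
      by (auto simp: image_def)
    have "?p (Suc n) = j \<otimes> a (Suc n) \<oplus> x \<otimes> (r \<otimes> a (Suc n))"
      using n j r x(1) a by (simp add: l_distr m_assoc)
    moreover have "r \<otimes> a (Suc n) \<in> H"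
      using H r a by (simp add: left_ideal_def)
    ultimately have "?p (Suc n) \<in> J"
      using xH right_idealD(2)[OF J(1) j] a by simp
    then show False
      using J(3) by blast
  qed
  note hit = this
  have "limitin T (partial_product R a) \<zero> sequentially" if a: "\<And>n. a n \<in> H" for a
    unfolding limitin_def
  proof (intro conjI allI impI)
    show "\<zero> \<in> topspace T"
      by (simp add: topspace_eq)
    fix W assume "openin T W \<and> \<zero> \<in> W"
    then obtain I where I: "right_ideal I R" "openin T I" "I \<subseteq> W"
      using assms(2) by (auto simp: right_linear_topology_def)
    obtain n where n: "partial_product R a n \<in> I"
      using hit[where a = a, OF a I(1,2)] by blast
    \<comment> \<open>Once a partial product lies in the right ideal \<open>I\<close>, all later
      ones do, since they arise by multiplying on the right. A single hit therefore gives
      convergence.\<close>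
    have "partial_product R a m \<in> I" if "n \<le> m" for m
      using that n a by (induction m rule: dec_induct) (auto intro: right_idealD(2)[OF I(1)])
    then show "\<forall>\<^sub>F m in sequentially. partial_product R a m \<in> W"
      using I(3) by (auto simp: eventually_sequentially)
  qed
  then show ?thesis
    \<comment> \<open>Convergence in the subspace topology also requires the terms to lie in
      \<open>H\<close>.\<close>
    using partial_product_left_ideal[OF H]
    by (simp add: topologically_left_T_nilpotent_def limitin_subtopology)
qed

text \<open>The equivalence is stated over one carrier type large enough for the converse; the
  second conjunct gives the forward implication for an arbitrary carrier type
  \<open>'n\<close>.\<close>

theorem lemma6p1:
  fixes R :: "('a, 'm) ring_scheme" and T :: "'a topology" and H :: "'a set"
  assumes "topological_ring R T"
    and "separated_ring R T"
    and "complete_ring R T"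
    and "right_linear_topology R T"
    and "left_ideal H R"
  shows
    "(topologically_left_T_nilpotent (R\<lparr>carrier := H\<rparr>) (subtopology T H) \<longleftrightarrow>
        (\<forall>N :: ('a, 'a set) right_module.
           discrete_right_module R T N \<and> carrier N \<noteq> {\<zero>\<^bsub>N\<^esub>} \<longrightarrow>
           annihilated_part N H \<noteq> {\<zero>\<^bsub>N\<^esub>})) \<and>
     (topologically_left_T_nilpotent (R\<lparr>carrier := H\<rparr>) (subtopology T H) \<longrightarrow>
        (\<forall>N :: ('a, 'n) right_module.
           discrete_right_module R T N \<and> carrier N \<noteq> {\<zero>\<^bsub>N\<^esub>} \<longrightarrow>
           annihilated_part N H \<noteq> {\<zero>\<^bsub>N\<^esub>}))"
proof (intro conjI iffI impI allI)
  fix N :: "('a, 'a set) right_module"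
  assume "topologically_left_T_nilpotent (R\<lparr>carrier := H\<rparr>) (subtopology T H)"
    and "discrete_right_module R T N \<and> carrier N \<noteq> {\<zero>\<^bsub>N\<^esub>}"
  then show "annihilated_part N H \<noteq> {\<zero>\<^bsub>N\<^esub>}"
    by (elim conjE) (rule T_nilpotent_imp_annihilated_part_nonzero[OF assms(1,5)])
next
  assume ann: "\<forall>N :: ('a, 'a set) right_module.
    discrete_right_module R T N \<and> carrier N \<noteq> {\<zero>\<^bsub>N\<^esub>} \<longrightarrow> annihilated_part N H \<noteq> {\<zero>\<^bsub>N\<^esub>}"
  show "topologically_left_T_nilpotent (R\<lparr>carrier := H\<rparr>) (subtopology T H)"
    by (rule annihilated_part_nonzero_imp_T_nilpotent[OF assms(1,4,5)])
      (rule ann[rule_format, OF conjI])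
next
  fix N :: "('a, 'n) right_module"
  assume "topologically_left_T_nilpotent (R\<lparr>carrier := H\<rparr>) (subtopology T H)"
    and "discrete_right_module R T N \<and> carrier N \<noteq> {\<zero>\<^bsub>N\<^esub>}"
  then show "annihilated_part N H \<noteq> {\<zero>\<^bsub>N\<^esub>}"
    by (elim conjE) (rule T_nilpotent_imp_annihilated_part_nonzero[OF assms(1,5)])
qed

end
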